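(* Let $m$ be a positive integer. Then $m \in \operatorname{Im}(P)$ (i.e. $m = P(M)$ for some $M \in \mathcal{M}$) if and only if $m$ admits a $t$-squared partition for some positive integer $t$, i.e. there exist a positive integer $t$ and positive integers $c_1,\ldots,c_t$ such that $$m = (c_1+\cdots+c_t)^2 + 2(c_1^2+\cdots+c_t^2).$$
   Context: Let $\mathcal{M}$ be the set of all two-line matrices $M=\begin{pmatrix} c_1 & c_2 & \cdots & c_s\\ d_1 & d_2 & \cdots & d_s\end{pmatrix}$ ($s\ge 1$) with non-negative integer entries satisfying $c_s=0$, $d_s\neq 0$, and $c_j=c_{j+1}+d_{j+1}$ for $j=1,\ldots,s-1$. Let $\ell(M)$ be the sum of all entries of $M$ and put $N=\ell(M)-d_1$. The Path Procedure associates to $M$ the collection of "hook" parts $$\lambda_{k,i} = 2\Big(N - (d_2+\cdots+d_k) - (c_1+\cdots+c_{k-1}) - i\Big) - 1,\qquad k=1,\ldots,s-1,\ i=0,\ldots,c_k-1$$ (empty sums are $0$), which form a partition into distinct odd parts greater than $1$. Define $P:\mathcal{M}\to\mathbb{Z}_{\ge 0}$ by $P(M)=\sum_{k,i}\lambda_{k,i}$ (so $P(M)=0$ when $s=1$). A positive integer $m$ admits a $t$-squared partition if $m=b^2+c_1^2+\cdots+c_t^2+c_1^2+\cdots+c_t^2$ with $b=c_1+\cdots+c_t$ and $c_1,\ldots,c_t$ positive integers. *)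

theory Defs
  imports Main
begin

text \<open>A two-line matrix is the list of its columns \<open>(c\<^sub>j, d\<^sub>j)\<close>; \<open>c_entry M j\<close> and \<open>d_entry M j\<close>
  use the 1-based column index \<open>1 \<le> j \<le> length M\<close>.\<close>

type_synonym two_line_matrix = "(nat \<times> nat) list"

definition c_entry :: "two_line_matrix \<Rightarrow> nat \<Rightarrow> nat" where
  "c_entry M j = fst (M ! (j - 1))"

definition d_entry :: "two_line_matrix \<Rightarrow> nat \<Rightarrow> nat" where
  "d_entry M j = snd (M ! (j - 1))"

definition two_line_matrices :: "two_line_matrix set" where
  "two_line_matrices =
     {M. length M \<ge> 1 \<and> c_entry M (length M) = 0 \<and> d_entry M (length M) \<noteq> 0 \<and>
         (\<forall>j\<in>{1..<length M}. c_entry M j = c_entry M (j + 1) + d_entry M (j + 1))}"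

definition entry_sum :: "two_line_matrix \<Rightarrow> nat" where
  "entry_sum M = (\<Sum>j=1..length M. c_entry M j + d_entry M j)"

text \<open>The hook parts are integers, so that no subtraction is truncated.\<close>

definition hook_part :: "two_line_matrix \<Rightarrow> nat \<Rightarrow> nat \<Rightarrow> int" where
  "hook_part M k i =
     (let N = int (entry_sum M) - int (d_entry M 1)
      in 2 * (N - (\<Sum>j=2..k. int (d_entry M j)) - (\<Sum>j=1..<k. int (c_entry M j)) - int i) - 1)"

definition path_sum :: "two_line_matrix \<Rightarrow> int" where
  "path_sum M = (\<Sum>k=1..<length M. \<Sum>i<c_entry M k. hook_part M k i)"

definition admits_squared_partition :: "nat \<Rightarrow> nat \<Rightarrow> bool" where
  "admits_squared_partition t m \<longleftrightarrow>
     (\<exists>(b::nat) (c::nat \<Rightarrow> nat). (\<forall>i\<in>{1..t}. c i > 0) \<and> b = (\<Sum>i=1..t. c i) \<and>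
        m = b\<^sup>2 + (\<Sum>i=1..t. (c i)\<^sup>2) + (\<Sum>i=1..t. (c i)\<^sup>2))"

end

theory Submission imports Defs "HOL-Library.Multiset" begin

text \<open>Since \<open>d\<^sub>2 + \<dots> + d\<^sub>k = c\<^sub>1 - c\<^sub>k\<close>, the parts of index \<open>k\<close> are \<open>2 (c\<^sub>k + S\<^sub>k - i) - 1\<close> with
  \<open>S\<^sub>k = c\<^sub>k + \<dots> + c\<^sub>s\<^sub>-\<^sub>1\<close>. They add up to \<open>c\<^sub>k\<^sup>2 + 2 c\<^sub>k S\<^sub>k = 2 c\<^sub>k\<^sup>2 + S\<^sub>k\<^sup>2 - S\<^sub>k\<^sub>+\<^sub>1\<^sup>2\<close>, so \<open>P(M)\<close> telescopes to
  \<open>S\<^sub>1\<^sup>2 + 2 (c\<^sub>1\<^sup>2 + \<dots> + c\<^sub>s\<^sub>-\<^sub>1\<^sup>2)\<close>. The sequences \<open>c\<^sub>1, \<dots>, c\<^sub>s\<^sub>-\<^sub>1\<close> that occur are exactly the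
  nonincreasing positive ones, and the squared partition does not depend on the order.\<close>

lemma sum_hook_arith:
  "(\<Sum>i<n. 2 * (A - int i) - 1) = 2 * int n * A - (int n)\<^sup>2"
  by (induction n) (auto simp: algebra_simps power2_eq_square)

text \<open>With \<open>P\<close> the partial sum before \<open>x k\<close>, the right side grows by
  \<open>2 * x k * (T - P) + (x k)\<^sup>2\<close>, since
  \<open>(P + x k)\<^sup>2 - P\<^sup>2 = 2 * x k * P + (x k)\<^sup>2\<close>. Keeping
  \<open>T\<close> independent of \<open>n\<close> lets the induction run; the total sum is put in
  for \<open>T\<close> afterwards.\<close>

lemma sum_hooks_telescope:
  fixes x :: "nat \<Rightarrow> int"
  assumes "n \<ge> 1"
  shows "(\<Sum>k=1..<n. (x k)\<^sup>2 + 2 * x k * (T - (\<Sum>j=1..<k. x j)))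
    = 2 * T * (\<Sum>k=1..<n. x k) - (\<Sum>k=1..<n. x k)\<^sup>2 + 2 * (\<Sum>k=1..<n. (x k)\<^sup>2)"
  using assms
  by (induction n rule: dec_induct) (auto simp: algebra_simps power2_eq_square)

lemma path_sum_eq:
  assumes "M \<in> two_line_matrices"
  shows "path_sum M = int ((\<Sum>k=1..<length M. c_entry M k)\<^sup>2 + 2 * (\<Sum>k=1..<length M. (c_entry M k)\<^sup>2))"
proof -
  define s where "s = length M"
  define c where "c j = int (c_entry M j)" for j
  define d where "d j = int (d_entry M j)" for j
  define T where "T = (\<Sum>j=1..<s. c j)"
  have s: "s \<ge> 1" and cs: "c s = 0" and rec: "\<And>j. j \<in> {1..<s} \<Longrightarrow> c j = c (Suc j) + d (Suc j)"
    using assms by (auto simp: two_line_matrices_def s_def c_def d_def)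
  have d_sum: "(\<Sum>j=2..k. d j) = c 1 - c k" if "k \<ge> 1" "k \<le> s" for k
    using that
  proof (induction k rule: dec_induct)
    case (step k)
    then show ?case using rec[of k] by simp
  qed simp
  \<comment> \<open>As \<open>c s = 0\<close>, the bottom row without \<open>d 1\<close> telescopes
    to \<open>c 1\<close>.\<close>
  have N: "int (entry_sum M) - d 1 = T + c 1"
  proof -
    have "int (entry_sum M) = (\<Sum>j=1..s. c j) + (\<Sum>j=1..s. d j)"
      by (simp add: entry_sum_def c_def d_def s_def sum.distrib)
    moreover have "(\<Sum>j=1..s. c j) = T"
      using s cs by (simp add: T_def sum.last_plus)
    moreover have "(\<Sum>j=1..s. d j) = d 1 + (\<Sum>j=2..s. d j)"
      using s by (simp add: sum.atLeast_Suc_atMost numeral_2_eq_2)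
    ultimately show ?thesis using d_sum[of s] s cs by simp
  qed
  have "path_sum M = (\<Sum>k=1..<s. (c k)\<^sup>2 + 2 * c k * (T - (\<Sum>j=1..<k. c j)))"
    unfolding path_sum_def s_def[symmetric]
  proof (rule sum.cong[OF refl])
    fix k assume k: "k \<in> {1..<s}"
    \<comment> \<open>Subtracting \<open>c 1 - c k\<close> from \<open>T + c 1\<close> leaves
      \<open>T + c k\<close>.\<close>
    have "hook_part M k i = 2 * (c k + T - (\<Sum>j=1..<k. c j) - int i) - 1" for i
      using N d_sum[of k] k by (simp add: hook_part_def Let_def c_def[symmetric] d_def[symmetric])
    then show "(\<Sum>i<c_entry M k. hook_part M k i) = (c k)\<^sup>2 + 2 * c k * (T - (\<Sum>j=1..<k. c j))"
      by (simp only: sum_hook_arith c_def[symmetric]) (simp add: algebra_simps power2_eq_square)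
  qed
  also have "\<dots> = T\<^sup>2 + 2 * (\<Sum>k=1..<s. (c k)\<^sup>2)"
    by (simp only: sum_hooks_telescope[OF s] T_def[symmetric]) (simp add: power2_eq_square)
  finally show ?thesis by (simp add: T_def c_def s_def)
qed

text \<open>Downward induction: the entry before the last equals the nonzero last \<open>d\<close>,
  and the top row can only grow towards the left.\<close>

lemma c_entry_pos:
  assumes M: "M \<in> two_line_matrices" and k: "1 \<le> k" "k < length M"
  shows "c_entry M k > 0"
proof -
  have rec: "c_entry M j = c_entry M (Suc j) + d_entry M (Suc j)" if "1 \<le> j" "j < length M" for j
    using M that by (auto simp: two_line_matrices_def)
  have last: "d_entry M (length M) > 0"
    using M by (auto simp: two_line_matrices_def)
  have "k \<le> length M - 1" using k by simp
  then show ?thesis using k(1)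
  proof (induction rule: inc_induct)
    case base
    then show ?case using rec[of "length M - 1"] last k
      by (metis Suc_diff_1 add_gr_0 diff_less less_numeral_extra(1) order.strict_trans1 zero_le)
  next
    case (step n)
    then show ?case using rec[of n] by simp
  qed
qed

text \<open>Sorting supplies the order that a top row must have. Equality of images carries
  positivity over to \<open>g\<close>; equality of sums for every \<open>f\<close> covers both the
  linear and the quadratic sum.\<close>

lemma exists_antitone_rearrangement:
  fixes c :: "nat \<Rightarrow> nat"
  obtains g :: "nat \<Rightarrow> nat" where "\<And>i j. 1 \<le> i \<Longrightarrow> i \<le> j \<Longrightarrow> j \<le> t \<Longrightarrow> g j \<le> g i"
    "g ` {1..t} = c ` {1..t}" "\<And>f :: nat \<Rightarrow> nat. (\<Sum>i=1..t. f (g i)) = (\<Sum>i=1..t. f (c i))"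
proof -
  define xs where "xs = rev (sort (map c [1..<Suc t]))"
  have len: "length xs = t" by (simp add: xs_def)
  have shift: "{1..t} = Suc ` {..<t}"
    by (simp add: lessThan_atLeast0 atLeastLessThanSuc_atLeastAtMost)
  show ?thesis
  proof
    show "xs ! (j - 1) \<le> xs ! (i - 1)" if "1 \<le> i" "i \<le> j" "j \<le> t" for i j
      using that sorted_rev_nth_mono[of xs "i - 1" "j - 1"] len by (simp add: xs_def)
    have "(\<lambda>i. xs ! (i - 1)) ` {1..t} = set xs"
      unfolding shift by (auto simp: image_image in_set_conv_nth len)
    then show "(\<lambda>i. xs ! (i - 1)) ` {1..t} = c ` {1..t}"
      by (simp add: xs_def atLeastLessThanSuc_atLeastAtMost del: upt_Suc)
    show "(\<Sum>i=1..t. f (xs ! (i - 1))) = (\<Sum>i=1..t. f (c i))" for f :: "nat \<Rightarrow> nat"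
    proof -
      have "(\<Sum>i=1..t. f (xs ! (i - 1))) = sum_list (map f xs)"
        unfolding shift sum.reindex[OF inj_Suc] by (simp add: sum_list_sum_nth len lessThan_atLeast0)
      \<comment> \<open>Multisets forget the order, so sorting and reversal disappear.\<close>
      also have "\<dots> = sum_mset (image_mset f (mset xs))"
        by (metis mset_map sum_mset_sum_list)
      also have "mset xs = mset (map c [1..<Suc t])"
        by (simp add: xs_def del: upt_Suc)
      also have "sum_mset (image_mset f \<dots>) = sum_list (map (\<lambda>i. f (c i)) [1..<Suc t])"
        by (metis (no_types, lifting) map_map comp_apply map_cong mset_map sum_mset_sum_list)
      also have "\<dots> = (\<Sum>i=1..t. f (c i))"
        by (simp add: sum_list_distinct_conv_sum_set atLeastLessThanSuc_atLeastAtMost del: upt_Suc)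
      finally show ?thesis .
    qed
  qed
qed

text \<open>Take \<open>g\<close> as top row and its successive drops as bottom row; monotonicity
  keeps the natural subtraction exact.\<close>

lemma exists_matrix_of_antitone:
  fixes g :: "nat \<Rightarrow> nat"
  assumes t: "t > 0" and anti: "\<And>i j. 1 \<le> i \<Longrightarrow> i \<le> j \<Longrightarrow> j \<le> t \<Longrightarrow> g j \<le> g i"
    and pos: "\<And>i. 1 \<le> i \<Longrightarrow> i \<le> t \<Longrightarrow> g i > 0"
  obtains M where "M \<in> two_line_matrices" "length M = Suc t"
    "\<And>k. 1 \<le> k \<Longrightarrow> k \<le> t \<Longrightarrow> c_entry M k = g k"
proof -
  \<comment> \<open>Padding with 0 gives the final column \<open>c = 0\<close> and
    \<open>d = g t > 0\<close>.\<close>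
  define h where "h j = (if j \<le> t then g j else 0)" for j
  \<comment> \<open>List position \<open>j\<close> holds column \<open>j + 1\<close>; the first
    column has no predecessor, so its \<open>d\<close> is free and set to 0.\<close>
  define M where "M = map (\<lambda>j. (h (Suc j), if j = 0 then 0 else h j - h (Suc j))) [0..<Suc t]"
  have len: "length M = Suc t" by (simp add: M_def)
  have c: "c_entry M j = h j" if "1 \<le> j" "j \<le> Suc t" for j
    using that by (cases j) (simp_all add: M_def c_entry_def del: upt_Suc)
  have d: "d_entry M j = h (j - 1) - h j" if "2 \<le> j" "j \<le> Suc t" for j
    using that by (cases j) (simp_all add: M_def d_entry_def del: upt_Suc)
  have h: "h (Suc j) \<le> h j" if "1 \<le> j" for j
    using anti[of j "Suc j"] that by (simp add: h_def)
  show ?thesis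
  proof
    show "M \<in> two_line_matrices"
      using t pos[of t] h by (auto simp: two_line_matrices_def len c d) (simp_all add: h_def)
    show "length M = Suc t" by (fact len)
    show "c_entry M k = g k" if "1 \<le> k" "k \<le> t" for k
      using that c[of k] by (simp add: h_def)
  qed
qed

theorem theorem3p2:
  fixes m :: nat
  assumes "m > 0"
  shows "int m \<in> path_sum ` two_line_matrices \<longleftrightarrow> (\<exists>t>0. admits_squared_partition t m)"
proof
  assume "int m \<in> path_sum ` two_line_matrices"
  then obtain M where M: "M \<in> two_line_matrices" and "int m = path_sum M" by blast
  then have m: "m = (\<Sum>k=1..<length M. c_entry M k)\<^sup>2 + 2 * (\<Sum>k=1..<length M. (c_entry M k)\<^sup>2)"
    by (simp only: path_sum_eq[OF M] of_nat_eq_iff)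
  define t where "t = length M - 1"
  have "length M \<ge> 1" using M unfolding two_line_matrices_def by blast
  then have int: "{1..<length M} = {1..t}" by (auto simp: t_def)
  \<comment> \<open>For \<open>t = 0\<close> both sums are empty, which would force
    \<open>m = 0\<close>.\<close>
  have "t > 0" using m assms unfolding int by (cases t) auto
  moreover have "\<forall>k\<in>{1..t}. c_entry M k > 0"
    using c_entry_pos[OF M] unfolding int[symmetric] by simp
  then have "admits_squared_partition t m"
    using m unfolding admits_squared_partition_def int
    by (intro exI[of _ "\<Sum>k=1..t. c_entry M k"] exI[of _ "c_entry M"]) simp
  ultimately show "\<exists>t>0. admits_squared_partition t m" by blast
next
  assume "\<exists>t>0. admits_squared_partition t m"
  then obtain t b :: nat and c :: "nat \<Rightarrow> nat" where t: "t > 0" and pos: "\<forall>i\<in>{1..t}. c i > 0"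
    and b: "b = (\<Sum>i=1..t. c i)"
    and m: "m = b\<^sup>2 + (\<Sum>i=1..t. (c i)\<^sup>2) + (\<Sum>i=1..t. (c i)\<^sup>2)"
    unfolding admits_squared_partition_def by blast
  obtain g where anti: "\<And>i j. 1 \<le> i \<Longrightarrow> i \<le> j \<Longrightarrow> j \<le> t \<Longrightarrow> g j \<le> g i"
    and im: "g ` {1..t} = c ` {1..t}"
    and sums: "\<And>f :: nat \<Rightarrow> nat. (\<Sum>i=1..t. f (g i)) = (\<Sum>i=1..t. f (c i))"
    by (rule exists_antitone_rearrangement[of t c]) blast
  have "g i > 0" if "1 \<le> i" "i \<le> t" for i
  proof -
    have "g i \<in> c ` {1..t}" using that im by (metis atLeastAtMost_iff imageI)
    then show ?thesis using pos by auto
  qed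
  with t anti obtain M where M: "M \<in> two_line_matrices" and len: "length M = Suc t"
    and c: "\<And>k. 1 \<le> k \<Longrightarrow> k \<le> t \<Longrightarrow> c_entry M k = g k"
    by (rule exists_matrix_of_antitone) blast+
  have "path_sum M = int m"
    using sums[of "\<lambda>x. x"] sums[of "\<lambda>x. x\<^sup>2"]
    unfolding path_sum_eq[OF M] len atLeastLessThanSuc_atLeastAtMost m b
    by (simp add: c)
  then show "int m \<in> path_sum ` two_line_matrices" using M by (metis imageI)
qed

end
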